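(* For integers $n,k$ with $\lfloor 5k/2\rfloor\leq n\leq 3k-2$, the metric dimension of the Kneser graph $K(n,k)$ satisfies \[ \beta(K(n,k))\leq 2\binom{n-k}{k}. \]
   Context: The Kneser graph $K(n,k)$ has as vertices the $k$-subsets of $[n]=\{1,\dots,n\}$, two being adjacent when they are disjoint. A resolving set of a connected graph is a set $S$ of vertices such that for every pair of distinct vertices $u,v$ there is $x\in S$ with $d(u,x)\neq d(v,x)$; the metric dimension $\beta$ is the minimum size of a resolving set. *)

theory Defs
  imports "Graph_Theory.Graph_Theory"
begin

text \<open>
  Undirected graphs are symmetric digraphs, as in the locale \<^locale>\<open>graph\<close>. Requiring
  \<open>A \<noteq> B\<close> only matters for \<open>k = 0\<close>, where the empty set is disjoint from itself and would
  otherwise carry a loop.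
\<close>

definition kneser_graph :: "nat \<Rightarrow> nat \<Rightarrow> nat set pair_pre_digraph" where
  "kneser_graph n k =
     (let V = {A. A \<subseteq> {1..n} \<and> card A = k}
      in \<lparr> pverts = V,
           parcs = {(A, B). A \<in> V \<and> B \<in> V \<and> A \<noteq> B \<and> A \<inter> B = {}} \<rparr>)"

text \<open>
  The usual graph distance: with unit arc weights, the cost of a walk is its number of arcs.
  The value is \<open>\<infinity>\<close> if no walk exists, which does not happen in connected graphs.
\<close>

definition graph_dist :: "('a, 'b) pre_digraph \<Rightarrow> 'a \<Rightarrow> 'a \<Rightarrow> ereal" where
  "graph_dist G u v = wf_digraph.\<mu> G (\<lambda>_. 1) u v"

definition resolving_set :: "('a, 'b) pre_digraph \<Rightarrow> 'a set \<Rightarrow> bool" where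
  "resolving_set G S \<longleftrightarrow> S \<subseteq> verts G \<and>
     (\<forall>u \<in> verts G. \<forall>v \<in> verts G. u \<noteq> v \<longrightarrow>
        (\<exists>x \<in> S. graph_dist G u x \<noteq> graph_dist G v x))"

text \<open>
  Meaningful for finite graphs, where the minimum exists because the set of all vertices is
  resolving. Finiteness of \<open>S\<close> is required since \<^const>\<open>card\<close> is \<open>0\<close> on infinite sets.
\<close>

definition metric_dimension :: "('a, 'b) pre_digraph \<Rightarrow> nat" where
  "metric_dimension G = (LEAST m. \<exists>S. resolving_set G S \<and> finite S \<and> card S = m)"

lemma pverts_kneser_graph [simp]:
  "A \<in> pverts (kneser_graph n k) \<longleftrightarrow> A \<subseteq> {1..n} \<and> card A = k"
  by (simp add: kneser_graph_def Let_def)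

lemma parcs_kneser_graph [simp]:
  "(A, B) \<in> parcs (kneser_graph n k) \<longleftrightarrow>
     A \<in> pverts (kneser_graph n k) \<and> B \<in> pverts (kneser_graph n k) \<and> A \<noteq> B \<and> A \<inter> B = {}"
  by (simp add: kneser_graph_def Let_def)

lemma pair_graph_kneser_graph: "pair_graph (kneser_graph n k)"
proof
  have sub: "parcs (kneser_graph n k) \<subseteq> pverts (kneser_graph n k) \<times> pverts (kneser_graph n k)"
    unfolding subset_iff split_paired_All parcs_kneser_graph by blast
  show "fst e \<in> pverts (kneser_graph n k)" if "e \<in> parcs (kneser_graph n k)" for e
    using subsetD[OF sub that] by (simp only: mem_Times_iff)
  show "snd e \<in> pverts (kneser_graph n k)" if "e \<in> parcs (kneser_graph n k)" for e
    using subsetD[OF sub that] by (simp only: mem_Times_iff)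
  show fin: "finite (pverts (kneser_graph n k))"
    by (rule finite_subset[of _ "Pow {1..n}"]) (simp_all add: subset_iff)
  show "finite (parcs (kneser_graph n k))"
    by (rule finite_subset[OF sub finite_cartesian_product[OF fin fin]])
  show "symmetric (with_proj (kneser_graph n k))"
    unfolding symmetric_def with_proj_simps
    by (rule symI) (simp only: parcs_kneser_graph, blast)
  show "fst e \<noteq> snd e" if "e \<in> parcs (kneser_graph n k)" for e
    using that by (cases e) (simp only: parcs_kneser_graph fst_conv snd_conv not_False_eq_True)
qed

end

(*
  Take all k-subsets of two sets X and Y of size n - k that together cover {1..n}. It suffices that
  the distances from u to the k-subsets x of X determine u Int X. Distance 0, 1 and at most 2
  mean x = u, x disjoint from u, and (for distinct intersecting sets) card (u Int x) >= 3k - n.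
  If u is contained in X, distance 0 identifies it. If some x is disjoint from u, then the union
  of all such x is X - u. Otherwise card (u Int X) > n - 2k, and because 5k/2 <= n this is large
  enough for the threshold 3k - n to be crossed by exchanging a single element of x.
*)

theory Submission
  imports Defs
begin

section \<open>Recovering a subset of \<open>X\<close> from families of \<open>k\<close>-subsets of
  \<open>X\<close>\<close>

lemma obtain_card_subset_mem:
  assumes "finite A" "i \<in> A" "1 \<le> k" "k \<le> card A"
  obtains x where "x \<subseteq> A" "i \<in> x" "card x = k"
proof -
  have "k - 1 \<le> card (A - {i})" using assms by simp
  then obtain P where P: "P \<subseteq> A - {i}" "card P = k - 1" "finite P"
    by (rule obtain_subset_with_card_n)
  then have "card (insert i P) = k"
    using assms(3) by (subst card_insert_disjoint) auto
  with P(1) assms(2) show thesis by (intro that[of "insert i P"]) auto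
qed

text \<open>An element of \<open>V\<close> in \<open>X - U\<close> would extend, since
  \<open>X - U\<close> has at least \<open>k\<close> elements, to a \<open>k\<close>-subset that
  avoids \<open>U\<close> but meets \<open>V\<close>.\<close>

lemma inter_subset_if_disjoint_subsets:
  assumes "finite X" "1 \<le> k" "k \<le> card (X - U)"
    and "\<And>x. x \<subseteq> X \<Longrightarrow> card x = k \<Longrightarrow> x \<inter> U = {} \<Longrightarrow> x \<inter> V = {}"
  shows "V \<inter> X \<subseteq> U"
proof (rule ccontr)
  assume "\<not> V \<inter> X \<subseteq> U"
  then obtain i where i: "i \<in> V" "i \<in> X - U" by auto
  obtain x where "x \<subseteq> X - U" "i \<in> x" "card x = k"
    using obtain_card_subset_mem[OF _ i(2) assms(2,3)] assms(1) by blast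
  with assms(4)[of x] i(1) show False by blast
qed

text \<open>
  Exchanging an element outside \<open>U\<close> for one inside \<open>U\<close> can move a set across the threshold, and
  the family of sets above the threshold for \<open>V\<close> must react in the same way.
\<close>

lemma inter_eq_if_same_threshold_family:
  assumes "finite X" "r \<le> k" "1 \<le> r" "r \<le> card (U \<inter> X)" "k - r < card (X - U)"
    and same: "\<And>x. x \<subseteq> X \<Longrightarrow> card x = k \<Longrightarrow> r \<le> card (x \<inter> U) \<longleftrightarrow> r \<le> card (x \<inter> V)"
  shows "U \<inter> X = V \<inter> X"
proof -
  have key: "i \<in> V \<and> j \<notin> V" if i: "i \<in> U \<inter> X" and j: "j \<in> X - U" for i j
  proof (rule ccontr)
    assume neg: "\<not> (i \<in> V \<and> j \<notin> V)"
    have "r - 1 \<le> card (U \<inter> X - {i})" using assms(1,4) i by simp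
    then obtain P where P: "P \<subseteq> U \<inter> X - {i}" "card P = r - 1" "finite P"
      by (rule obtain_subset_with_card_n)
    have "k - r \<le> card (X - U - {j})" using assms(1,5) j by simp
    then obtain Q where Q: "Q \<subseteq> X - U - {j}" "card Q = k - r" "finite Q"
      by (rule obtain_subset_with_card_n)
    \<comment> \<open>\<open>W\<close> has \<open>k - 1\<close> elements, exactly
      \<open>r - 1\<close> of them in \<open>U\<close>: adding \<open>i\<close> reaches the
      threshold for \<open>U\<close>, adding \<open>j\<close> stays one short.\<close>
    define W where "W = P \<union> Q"
    have "card W = k - 1"
      unfolding W_def using P Q assms(2,3) by (subst card_Un_disjoint) auto
    then have W: "finite W" "card W = k - 1" "i \<notin> W" "j \<notin> W" "W \<subseteq> X" "W \<inter> U = P" "i \<notin> P"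
      using P Q i j by (auto simp: W_def)
    have "card (insert j W) = k" "card (insert i W) = k"
      using W assms(2,3) by simp_all
    moreover have "insert j W \<inter> U = P" "insert i W \<inter> U = insert i P"
      using W i j by auto
    moreover have "card (insert i P) = r"
      using P W(7) assms(3) by simp
    ultimately have *: "r \<le> card (insert i W \<inter> V)" "\<not> r \<le> card (insert j W \<inter> V)"
      using same[of "insert j W"] same[of "insert i W"] P(2) W(5) assms(3) i j by auto
    \<comment> \<open>Replacing \<open>i\<close> by \<open>j\<close> loses an element of
      \<open>V\<close> only if \<open>i\<close> is in \<open>V\<close> and \<open>j\<close> is not,
      which \<open>neg\<close> excludes.\<close>
    have "card (insert i W \<inter> V) \<le> card (insert j W \<inter> V)"
      using neg W(1,3,4) by (cases "i \<in> V"; cases "j \<in> V") (simp_all add: Int_insert_left)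
    with * show False by simp
  qed
  \<comment> \<open>\<open>key\<close> speaks of pairs, so each inclusion needs a partner element
    from the other side.\<close>
  have "U \<inter> X \<noteq> {}" using assms(3,4) by auto
  moreover have "X - U \<noteq> {}" using assms(5) by (metis card.empty not_less_zero)
  ultimately show ?thesis using key by blast
qed

section \<open>Short distances in digraphs\<close>

text \<open>The distance is an infimum over walks. A strict bound turns it into the existence of a
  walk, with no need to show that the infimum is attained; hence all distance facts below are stated
  with \<open><\<close>.\<close>

lemma graph_dist_less_iff:
  assumes "wf_digraph G"
  shows "graph_dist G u v < ereal (real (Suc m)) \<longleftrightarrow> (\<exists>p. pre_digraph.awalk G u p v \<and> length p \<le> m)"
proof -
  interpret wf_digraph G by (rule assms)
  have "awalk_cost (\<lambda>_. 1) p = real (length p)" for p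
    by (induction p) (simp_all add: awalk_cost_def)
  then show ?thesis
    by (auto simp: graph_dist_def \<mu>_def INF_less_iff less_Suc_eq_le)
qed

context pair_wf_digraph
begin

lemma graph_dist_less_1_iff: "graph_dist G u v < 1 \<longleftrightarrow> u = v \<and> u \<in> pverts G"
  using graph_dist_less_iff[OF wf_digraph_axioms, of u v 0]
  by (simp add: awalk_Nil_iff one_ereal_def)

lemma graph_dist_less_Suc_iff:
  "graph_dist G u v < ereal (real (Suc (Suc m))) \<longleftrightarrow> u = v \<and> u \<in> pverts G
    \<or> (\<exists>w. (u, w) \<in> parcs G \<and> graph_dist G w v < ereal (real (Suc m)))"
  (is "?L \<longleftrightarrow> ?R")
proof
  assume ?L
  then obtain p where "awalk u p v" "length p \<le> Suc m"
    unfolding graph_dist_less_iff[OF wf_digraph_axioms] by blast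
  then show ?R
    unfolding graph_dist_less_iff[OF wf_digraph_axioms]
    by (cases p) (auto simp: awalk_simps)
next
  assume ?R
  then have "awalk u [] v \<or> (\<exists>e p. awalk u (e # p) v \<and> length p \<le> m)"
    unfolding graph_dist_less_iff[OF wf_digraph_axioms] by (force simp: awalk_simps)
  then show ?L
    unfolding graph_dist_less_iff[OF wf_digraph_axioms]
    by (metis Suc_le_mono length_Cons list.size(3) zero_le)
qed

lemma graph_dist_less_2_iff:
  "graph_dist G u v < 2 \<longleftrightarrow> u = v \<and> u \<in> pverts G \<or> (u, v) \<in> parcs G"
proof -
  have nums: "ereal (real (Suc (Suc 0))) = 2" "ereal (real (Suc 0)) = 1" by simp_all
  show ?thesis
    using graph_dist_less_Suc_iff[of u v 0, unfolded nums graph_dist_less_1_iff] in_arcsD2 by blast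
qed

lemma graph_dist_less_3_iff:
  "graph_dist G u v < 3 \<longleftrightarrow> u = v \<and> u \<in> pverts G \<or> (u, v) \<in> parcs G
    \<or> (\<exists>w. (u, w) \<in> parcs G \<and> (w, v) \<in> parcs G)"
proof -
  have nums: "ereal (real (Suc (Suc 1))) = 3" "ereal (real (Suc 1)) = 2" by simp_all
  show ?thesis
    using graph_dist_less_Suc_iff[of u v 1, unfolded nums graph_dist_less_2_iff] in_arcsD2 by blast
qed

end

section \<open>Short distances in Kneser graphs\<close>

context
  fixes n k :: nat and u x :: "nat set"
  assumes u: "u \<subseteq> {1..n}" "card u = k" and x: "x \<subseteq> {1..n}" "card x = k"
begin

interpretation pair_graph "kneser_graph n k"
  by (rule pair_graph_kneser_graph)

lemma kneser_dist_less_1_iff: "graph_dist (kneser_graph n k) u x < 1 \<longleftrightarrow> u = x"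
  unfolding graph_dist_less_1_iff using u by auto

lemma kneser_dist_less_2_iff: "graph_dist (kneser_graph n k) u x < 2 \<longleftrightarrow> u = x \<or> u \<inter> x = {}"
  unfolding graph_dist_less_2_iff using u x by auto

text \<open>A common neighbour of \<open>u\<close> and \<open>x\<close> is a \<open>k\<close>-subset
  of the complement of their union, which has \<open>n - 2 * k + card (u \<inter> x)\<close>
  elements.\<close>

lemma kneser_dist_less_3_iff:
  assumes "1 \<le> k" "2 * k \<le> n"
  shows "graph_dist (kneser_graph n k) u x < 3 \<longleftrightarrow> u \<inter> x = {} \<or> 3 * k \<le> n + card (u \<inter> x)"
proof -
  have fin: "finite u" "finite x"
    using u x by (auto intro: finite_subset)
  have card_un: "card (u \<union> x) + card (u \<inter> x) = 2 * k"
    using card_Un_Int[OF fin] u x by simp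
  have "card ({1..n} - (u \<union> x)) = n - card (u \<union> x)"
    using u x fin by (subst card_Diff_subset) auto
  moreover have "card (u \<union> x) \<le> n"
    using card_mono[of "{1..n}" "u \<union> x"] u x by simp
  ultimately have compl: "card ({1..n} - (u \<union> x)) + 2 * k = n + card (u \<inter> x)"
    using card_un by simp
  have common: "(\<exists>w. (u, w) \<in> parcs (kneser_graph n k) \<and> (w, x) \<in> parcs (kneser_graph n k))
      \<longleftrightarrow> 3 * k \<le> n + card (u \<inter> x)" (is "?L \<longleftrightarrow> ?R")
  proof
    assume ?L
    then obtain w where "w \<subseteq> {1..n}" "card w = k" "u \<inter> w = {}" "w \<inter> x = {}"
      unfolding parcs_kneser_graph pverts_kneser_graph by blast
    then have "w \<subseteq> {1..n} - (u \<union> x)" "card w = k" by blast+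
    then have "k \<le> card ({1..n} - (u \<union> x))"
      using card_mono[of "{1..n} - (u \<union> x)" w] by simp
    with compl show ?R by simp
  next
    assume ?R
    then have "k \<le> card ({1..n} - (u \<union> x))" using compl by simp
    then obtain w where w: "w \<subseteq> {1..n} - (u \<union> x)" "card w = k" "finite w"
      by (rule obtain_subset_with_card_n)
    \<comment> \<open>Adjacency also demands distinct vertices; a nonempty \<open>w\<close> disjoint
      from \<open>u\<close> and \<open>x\<close> differs from both.\<close>
    then have "w \<inter> u = {}" "w \<inter> x = {}" "w \<noteq> {}" using assms(1) by auto
    then have "w \<noteq> u" "w \<noteq> x" "u \<inter> w = {}" "w \<inter> x = {}" by blast+
    with w u x show ?L by (intro exI[of _ w]) auto
  qed
  \<comment> \<open>Distance 0 is absorbed by the threshold condition because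
    \<open>2 * k \<le> n\<close>.\<close>
  have "3 * k \<le> n + card (u \<inter> x)" if "u = x"
    using that u assms(2) by simp
  then show ?thesis
    unfolding graph_dist_less_3_iff common using u x by auto
qed

end

lemma inter_eq_if_same_kneser_dists:
  assumes n: "5 * k div 2 \<le> n" "n + 2 \<le> 3 * k" and k: "1 \<le> k"
    and X: "X \<subseteq> {1..n}" "card X = n - k"
    and u: "u \<subseteq> {1..n}" "card u = k" and v: "v \<subseteq> {1..n}" "card v = k"
    and same: "\<And>x. x \<subseteq> X \<Longrightarrow> card x = k
      \<Longrightarrow> graph_dist (kneser_graph n k) u x = graph_dist (kneser_graph n k) v x"
  shows "u \<inter> X = v \<inter> X"
proof -
  have k2: "2 * k \<le> n" using n(1) by linarith
  have finX: "finite X" using X(1) finite_subset by blast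
  have eq: "u = x \<longleftrightarrow> v = x" and disj: "u = x \<or> u \<inter> x = {} \<longleftrightarrow> v = x \<or> v \<inter> x = {}"
    and thr: "u \<inter> x = {} \<or> 3 * k \<le> n + card (u \<inter> x) \<longleftrightarrow> v \<inter> x = {} \<or> 3 * k \<le> n + card (v \<inter> x)"
    if "x \<subseteq> X" "card x = k" for x
  proof -
    have x: "x \<subseteq> {1..n}" using that X(1) by blast
    note facts = kneser_dist_less_1_iff kneser_dist_less_2_iff kneser_dist_less_3_iff[OF _ _ _ _ k k2]
    show "u = x \<longleftrightarrow> v = x" "u = x \<or> u \<inter> x = {} \<longleftrightarrow> v = x \<or> v \<inter> x = {}"
      "u \<inter> x = {} \<or> 3 * k \<le> n + card (u \<inter> x) \<longleftrightarrow> v \<inter> x = {} \<or> 3 * k \<le> n + card (v \<inter> x)"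
      using facts[OF u x that(2)] facts[OF v x that(2)] same[OF that] by simp_all
  qed
  show ?thesis
  proof (cases "u \<subseteq> X \<or> v \<subseteq> X")
    case True
    then show ?thesis using eq[of u] eq[of v] u v by auto
  next
    case False
    \<comment> \<open>Neither \<open>u\<close> nor \<open>v\<close> lies in \<open>X\<close>, so
      neither can equal \<open>x\<close>.\<close>
    have disj: "x \<inter> u = {} \<longleftrightarrow> x \<inter> v = {}" if "x \<subseteq> X" "card x = k" for x
      using disj[OF that] that False by (auto simp: Int_commute)
    have split: "card (w \<inter> X) + card (X - w) = n - k" for w
      using card_Diff_subset_Int[of X w] card_mono[of X "w \<inter> X"] finX X(2) by (simp add: Int_commute)
    show ?thesis
    proof (cases "\<exists>x\<subseteq>X. card x = k \<and> x \<inter> u = {}")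
      case True
      then obtain x where x: "x \<subseteq> X" "card x = k" "x \<inter> u = {}" "x \<inter> v = {}"
        using disj by blast
      then have "x \<subseteq> X - u" "x \<subseteq> X - v" by blast+
      then have "k \<le> card (X - u)" "k \<le> card (X - v)"
        using x(2) finX card_mono by (metis finite_Diff)+
      then show ?thesis
        using inter_subset_if_disjoint_subsets[OF finX k, of u v]
          inter_subset_if_disjoint_subsets[OF finX k, of v u] disj by blast
    next
      case none: False
      have small: "card (X - u) < k"
      proof (rule ccontr)
        assume "\<not> card (X - u) < k"
        then have "k \<le> card (X - u)" by simp
        then obtain x where "x \<subseteq> X - u" "card x = k" "finite x"
          by (rule obtain_subset_with_card_n)
        with none show False by blast
      qed
      have "card (u \<inter> X) < k"
        using psubset_card_mono[of u "u \<inter> X"] False u(2) finite_subset[OF u(1)] by auto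
      with split[of u] small n k2
      \<comment> \<open>Both parts of \<open>X\<close> have fewer than \<open>k\<close> of its
        \<open>n - k\<close> elements, so each has at least \<open>n - 2 * k + 1\<close>. This is at
        least \<open>3 * k - n\<close> because \<open>2 * n \<ge> 5 * k - 1\<close>, and it exceeds
        \<open>k - (3 * k - n) = n - 2 * k\<close>.\<close>
      have bounds: "3 * k - n \<le> card (u \<inter> X)" "k - (3 * k - n) < card (X - u)"
        by linarith+
      show ?thesis
      proof (rule inter_eq_if_same_threshold_family[OF finX _ _ bounds])
        show "3 * k - n \<le> k" "1 \<le> 3 * k - n" using k2 n(2) by simp_all
        fix x assume x: "x \<subseteq> X" "card x = k"
        then show "3 * k - n \<le> card (x \<inter> u) \<longleftrightarrow> 3 * k - n \<le> card (x \<inter> v)"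
          \<comment> \<open>No \<open>x\<close> is disjoint from \<open>u\<close>, hence none from
            \<open>v\<close>, so only the threshold remains in \<open>thr\<close>.\<close>
          using thr[OF x] disj[OF x] none n(2) by (auto simp: Int_commute)
      qed
    qed
  qed
qed

theorem theorem2p4:
  fixes n k :: nat
  assumes "5 * k div 2 \<le> n" and "int n \<le> 3 * int k - 2"
  shows "metric_dimension (with_proj (kneser_graph n k)) \<le> 2 * ((n - k) choose k)"
proof -
  have n: "n + 2 \<le> 3 * k" and k: "1 \<le> k" and k2: "2 * k \<le> n"
    using assms by linarith+
  define subsets where "subsets X = {x. x \<subseteq> X \<and> card x = k}" for X :: "nat set"
  \<comment> \<open>The two end segments of length \<open>n - k\<close> leave no gap, as
    \<open>k \<le> n - k\<close>.\<close>
  define X Y where "X = {1..n - k}" and "Y = {k + 1..n}"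
  have XY: "X \<subseteq> {1..n}" "card X = n - k" "Y \<subseteq> {1..n}" "card Y = n - k" "X \<union> Y = {1..n}"
    using k2 by (auto simp: X_def Y_def)
  define S where "S = subsets X \<union> subsets Y"
  have subs: "finite (subsets X)" "finite (subsets Y)"
    "card (subsets X) = (n - k) choose k" "card (subsets Y) = (n - k) choose k"
    using XY n_subsets[of X k] n_subsets[of Y k] by (auto simp: subsets_def X_def Y_def)
  have "resolving_set (kneser_graph n k) S"
    unfolding resolving_set_def
  proof (intro conjI ballI impI)
    show "S \<subseteq> verts (kneser_graph n k)"
      using XY by (auto simp: S_def subsets_def)
  next
    fix u v
    assume "u \<in> verts (kneser_graph n k)" "v \<in> verts (kneser_graph n k)" "u \<noteq> v"
    then have uv: "u \<subseteq> {1..n}" "card u = k" "v \<subseteq> {1..n}" "card v = k" by simp_all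
    show "\<exists>x\<in>S. graph_dist (kneser_graph n k) u x \<noteq> graph_dist (kneser_graph n k) v x"
    proof (rule ccontr)
      assume "\<not> ?thesis"
      then have "u \<inter> X = v \<inter> X" "u \<inter> Y = v \<inter> Y"
        using inter_eq_if_same_kneser_dists[OF assms(1) n k XY(1,2) uv]
          inter_eq_if_same_kneser_dists[OF assms(1) n k XY(3,4) uv]
        by (auto simp: S_def subsets_def)
      with XY(5) uv(1,3) \<open>u \<noteq> v\<close> show False by blast
    qed
  qed
  then have "metric_dimension (kneser_graph n k) \<le> card S"
    unfolding metric_dimension_def using subs by (intro Least_le) (auto simp: S_def)
  also have "\<dots> \<le> 2 * ((n - k) choose k)"
    using card_Un_le[of "subsets X" "subsets Y"] subs by (simp add: S_def)
  finally show ?thesis .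
qed

end
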